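(* (Bounded influence of the scale-calibrated median.) Let $0<\varepsilon<1$, let $\alpha_{\rm sc}\in I_\varepsilon=[\varepsilon,2-\varepsilon]$, and let $m_0=m_{\alpha_{\rm sc}}$, $A_0=D_mG_{\alpha_{\rm sc}}(m_0)$, $B_0=\partial_\alpha G_\alpha(m_0)|_{\alpha=\alpha_{\rm sc}}$, $\psi_0(z)=\psi_{\alpha_{\rm sc}}(z;m_0)$. Then $\|\psi_0(z)\|_{g_1}\le1/\sqrt\varepsilon$ for all $z\notin\mathrm{Cut}(m_0)\cup\{m_0\}$, and if the influence function $\phi_\alpha$ of the calibrated scale $\widehat\alpha_{\rm sc}$ is bounded and $A_0$ is invertible, then the influence function of the scale-calibrated median, $$\mathrm{IF}_{\rm sc}(z)=-A_0^{-1}\{\psi_0(z)+B_0\phi_\alpha(z)\},$$ is bounded in $z$.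
   Context: Let $(M,g_M)$, $(N,g_N)$ be smooth, connected, complete Riemannian manifolds with geodesic distances $d_M,d_N$, $\mathcal M=M\times N$, $g_1=g_M\oplus g_N$. For $\alpha\in(0,2)$ let $d_\alpha((p,q),(x,y))=\{\alpha d_M(p,x)^2+(2-\alpha)d_N(q,y)^2\}^{1/2}$ and $\log_{(p,q)}(x,y)=(\log_px,\log_qy)$. $Z=(X,Y)$ is a random element of $\mathcal M$; $m_\alpha$ is the (unique) minimizer of $F_\alpha(m)=E[d_\alpha(m,Z)]$ over $\mathcal M$; $\psi_\alpha(z;m)=\log_mz/d_\alpha(m,z)\in T_m\mathcal M$ for $z\notin\mathrm{Cut}(m)\cup\{m\}$; $G_\alpha(m)=E[\psi_\alpha(Z;m)]$, assumed differentiable in $(\alpha,m)$ near $(\alpha_{\rm sc},m_0)$, with $D_m$ the covariant derivative. Here $\alpha_{\rm sc}=2s_N^2/(s_M^2+s_N^2)$, where $s_M,s_N\in(0,\infty)$ are the medians of $d_M(p_0,X)$ and $d_N(q_0,Y)$, and $p_0,q_0$ are the geometric medians of $X$ and $Y$, i.e. minimizers of $p\mapsto E[d_M(p,X)]$ and $q\mapsto E[d_N(q,Y)]$. The estimator $\widehat\alpha_{\rm sc}$ is obtained by replacing $p_0,q_0,s_M,s_N$ by their empirical versions from an i.i.d. sample $Z_1,\dots,Z_n$, and $\phi_\alpha$ is a mean-zero square-integrable function of $Z$ with $\sqrt n(\widehat\alpha_{\rm sc}-\alpha_{\rm sc})=n^{-1/2}\sum_{i=1}^n\phi_\alpha(Z_i)+o_{\mathbb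 P}(1)$. The influence function is considered at points $z\notin\mathrm{Cut}(m_0)\cup\{m_0\}$. *)

theory Defs
  imports "HOL-Probability.Probability"
begin

section \<open>Smooth Riemannian manifolds\<close>

text \<open>Both notions below are meant for open sets \<open>S\<close>.\<close>

fun Ck_on :: "nat \<Rightarrow> 'e::euclidean_space set \<Rightarrow> ('e \<Rightarrow> 'f::real_normed_vector) \<Rightarrow> bool" where
  "Ck_on 0 S f \<longleftrightarrow> continuous_on S f"
| "Ck_on (Suc k) S f \<longleftrightarrow> (\<forall>x\<in>S. f differentiable (at x)) \<and>
     (\<forall>v. Ck_on k S (\<lambda>x. frechet_derivative f (at x) v))"

definition smooth_on :: "'e::euclidean_space set \<Rightarrow> ('e \<Rightarrow> 'f::real_normed_vector) \<Rightarrow> bool" where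
  "smooth_on S f \<longleftrightarrow> (\<forall>k. Ck_on k S f)"

text \<open>
  The points of the manifold are all elements of the topological type \<open>'a\<close>. The smooth structure
  is given by an atlas indexed by points: \<open>chart M c\<close> is a chart on the open set
  \<open>chart_dom M c\<close>, which contains \<open>c\<close>. (Every smooth manifold has such an atlas: select, for
  every point, a chart around it.)

  The tangent space at \<open>p\<close> is the model space \<open>'e\<close>: a vector \<open>v :: 'e\<close> at \<open>p\<close> stands for the
  tangent vector whose coordinates in the chart \<open>chart M p\<close> are \<open>v\<close>. Its coordinates in
  another chart \<open>c\<close> around \<open>p\<close> are obtained with the derivative of the transition map.
  The bilinear form \<open>metric M p\<close> acts on the tangent space at \<open>p\<close> in this sense.
\<close>

record ('a, 'e) rmanifold =
  chart_dom :: "'a \<Rightarrow> 'a set"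
  chart :: "'a \<Rightarrow> 'a \<Rightarrow> 'e"
  metric :: "'a \<Rightarrow> 'e \<Rightarrow> 'e \<Rightarrow> real"

definition chart_img :: "('a, 'e) rmanifold \<Rightarrow> 'a \<Rightarrow> 'e set" where
  "chart_img M c = chart M c ` chart_dom M c"

definition chart_inv :: "('a, 'e) rmanifold \<Rightarrow> 'a \<Rightarrow> 'e \<Rightarrow> 'a" where
  "chart_inv M c = inv_into (chart_dom M c) (chart M c)"

definition transition :: "('a, 'e) rmanifold \<Rightarrow> 'a \<Rightarrow> 'a \<Rightarrow> 'e \<Rightarrow> 'e" where
  "transition M c c' = chart M c' \<circ> chart_inv M c"

definition smooth_atlas ::
    "('a::topological_space, 'e::euclidean_space) rmanifold \<Rightarrow> bool" where
  "smooth_atlas M \<longleftrightarrow>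
     (\<forall>c. open (chart_dom M c) \<and> c \<in> chart_dom M c \<and> open (chart_img M c) \<and>
          homeomorphism (chart_dom M c) (chart_img M c) (chart M c) (chart_inv M c)) \<and>
     (\<forall>c c'. smooth_on (chart M c ` (chart_dom M c \<inter> chart_dom M c')) (transition M c c'))"

text \<open>Coefficients of the metric in the chart \<open>c\<close>, at the point with coordinates \<open>x\<close>, applied to
  the coordinate vectors \<open>u\<close> and \<open>w\<close>.\<close>

definition metric_coeff ::
    "('a, 'e::euclidean_space) rmanifold \<Rightarrow> 'a \<Rightarrow> 'e \<Rightarrow> 'e \<Rightarrow> 'e \<Rightarrow> real" where
  "metric_coeff M c x u w =
     (let p = chart_inv M c x; D = frechet_derivative (transition M c p) (at x)
      in metric M p (D u) (D w))"

definition riemannian_manifold ::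
    "('a::{t2_space,second_countable_topology}, 'e::euclidean_space) rmanifold \<Rightarrow> bool" where
  "riemannian_manifold M \<longleftrightarrow> smooth_atlas M \<and>
     (\<forall>p. bilinear (metric M p) \<and> (\<forall>u w. metric M p u w = metric M p w u) \<and>
          (\<forall>u. u \<noteq> 0 \<longrightarrow> metric M p u u > 0)) \<and>
     (\<forall>c u w. smooth_on (chart_img M c) (\<lambda>x. metric_coeff M c x u w))"

definition tnorm :: "('a, 'e) rmanifold \<Rightarrow> 'a \<Rightarrow> 'e \<Rightarrow> real" where
  "tnorm M p v = sqrt (metric M p v v)"


subsection \<open>Geodesic distance and completeness\<close>

definition C1_curve_on ::
    "('a::topological_space, 'e::euclidean_space) rmanifold \<Rightarrow> real set \<Rightarrow> (real \<Rightarrow> 'a) \<Rightarrow> bool" where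
  "C1_curve_on M I \<gamma> \<longleftrightarrow> continuous_on I \<gamma> \<and>
     (\<forall>c. \<exists>D. continuous_on {t\<in>I. \<gamma> t \<in> chart_dom M c} D \<and>
        (\<forall>t\<in>I. \<gamma> t \<in> chart_dom M c \<longrightarrow>
           ((\<lambda>s. chart M c (\<gamma> s)) has_vector_derivative D t) (at t within I)))"

definition piecewise_C1_curve ::
    "('a::topological_space, 'e::euclidean_space) rmanifold \<Rightarrow> (real \<Rightarrow> 'a) \<Rightarrow> bool" where
  "piecewise_C1_curve M \<gamma> \<longleftrightarrow>
     (\<exists>T. finite T \<and> {0, 1} \<subseteq> T \<and> T \<subseteq> {0..1} \<and>
        (\<forall>a\<in>T. \<forall>b\<in>T. a < b \<and> {a<..<b} \<inter> T = {} \<longrightarrow> C1_curve_on M {a..b} \<gamma>))"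

definition velocity ::
    "('a, 'e::euclidean_space) rmanifold \<Rightarrow> (real \<Rightarrow> 'a) \<Rightarrow> real \<Rightarrow> 'e" where
  "velocity M \<gamma> t = vector_derivative (\<lambda>s. chart M (\<gamma> t) (\<gamma> s)) (at t)"

definition curve_length ::
    "('a, 'e::euclidean_space) rmanifold \<Rightarrow> (real \<Rightarrow> 'a) \<Rightarrow> real" where
  "curve_length M \<gamma> = integral {0..1} (\<lambda>t. tnorm M (\<gamma> t) (velocity M \<gamma> t))"

definition gdist ::
    "('a::topological_space, 'e::euclidean_space) rmanifold \<Rightarrow> 'a \<Rightarrow> 'a \<Rightarrow> real" where
  "gdist M p x = Inf {curve_length M \<gamma> |\<gamma>. piecewise_C1_curve M \<gamma> \<and> \<gamma> 0 = p \<and> \<gamma> 1 = x}"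

definition complete_connected_riemannian_manifold ::
    "('a::{t2_space,second_countable_topology}, 'e::euclidean_space) rmanifold \<Rightarrow> bool" where
  "complete_connected_riemannian_manifold M \<longleftrightarrow>
     riemannian_manifold M \<and> connected (UNIV :: 'a set) \<and>
     Metric_space.mcomplete UNIV (gdist M)"


subsection \<open>Levi-Civita connection\<close>

text \<open>Christoffel symbols in the chart \<open>c\<close> (coordinate expression of the covariant derivative of
  the constant field \<open>v\<close> in direction \<open>u\<close>), determined by the Koszul formula.\<close>

definition christoffel ::
    "('a, 'e::euclidean_space) rmanifold \<Rightarrow> 'a \<Rightarrow> 'e \<Rightarrow> 'e \<Rightarrow> 'e \<Rightarrow> 'e" where
  "christoffel M c x u v = (THE k. \<forall>w. 2 * metric_coeff M c x k w =
       frechet_derivative (\<lambda>y. metric_coeff M c y v w) (at x) u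
     + frechet_derivative (\<lambda>y. metric_coeff M c y u w) (at x) v
     - frechet_derivative (\<lambda>y. metric_coeff M c y u v) (at x) w)"

text \<open>Coordinates, in the chart \<open>c\<close>, of the vector field \<open>V\<close> at the point with coordinates \<open>x\<close>.\<close>

definition field_coords ::
    "('a, 'e::euclidean_space) rmanifold \<Rightarrow> 'a \<Rightarrow> ('a \<Rightarrow> 'e) \<Rightarrow> 'e \<Rightarrow> 'e" where
  "field_coords M c V x =
     (let p = chart_inv M c x
      in frechet_derivative (transition M p c) (at (chart M p p)) (V p))"

definition cov_deriv ::
    "('a, 'e::euclidean_space) rmanifold \<Rightarrow> ('a \<Rightarrow> 'e) \<Rightarrow> 'a \<Rightarrow> 'e \<Rightarrow> 'e" where
  "cov_deriv M V p w =
     frechet_derivative (field_coords M p V) (at (chart M p p)) w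
     + christoffel M p (chart M p p) w (V p)"


subsection \<open>Geodesics, exponential map, cut locus, logarithm\<close>

definition geodesic_on ::
    "('a::topological_space, 'e::euclidean_space) rmanifold \<Rightarrow> real set \<Rightarrow> (real \<Rightarrow> 'a) \<Rightarrow> bool" where
  "geodesic_on M I \<gamma> \<longleftrightarrow> continuous_on I \<gamma> \<and>
     (\<forall>c. \<exists>D. \<forall>t\<in>I. \<gamma> t \<in> chart_dom M c \<longrightarrow>
        ((\<lambda>s. chart M c (\<gamma> s)) has_vector_derivative D t) (at t within I) \<and>
        (D has_vector_derivative - christoffel M c (chart M c (\<gamma> t)) (D t) (D t)) (at t within I))"

text \<open>On a complete manifold the exponential map is defined on the whole tangent space.\<close>

definition rexp ::
    "('a::topological_space, 'e::euclidean_space) rmanifold \<Rightarrow> 'a \<Rightarrow> 'e \<Rightarrow> 'a" where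
  "rexp M p v = (THE x. \<exists>\<gamma>. geodesic_on M {0..1} \<gamma> \<and> \<gamma> 0 = p \<and> \<gamma> 1 = x \<and>
     ((\<lambda>s. chart M p (\<gamma> s)) has_vector_derivative v) (at 0 within {0..1}))"

text \<open>The geodesic \<open>t \<mapsto> rexp M p (t v)\<close> is minimizing on \<open>[0, b]\<close>.\<close>

definition minimizing_upto ::
    "('a::topological_space, 'e::euclidean_space) rmanifold \<Rightarrow> 'a \<Rightarrow> 'e \<Rightarrow> real \<Rightarrow> bool" where
  "minimizing_upto M p v b \<longleftrightarrow>
     (\<forall>t\<in>{0..b}. gdist M p (rexp M p (t *\<^sub>R v)) = t * tnorm M p v)"

definition injectivity_domain ::
    "('a::topological_space, 'e::euclidean_space) rmanifold \<Rightarrow> 'a \<Rightarrow> 'e set" where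
  "injectivity_domain M p = {v. \<exists>b>1. minimizing_upto M p v b}"

text \<open>A cut point of \<open>p\<close> is the last point up to which a geodesic from \<open>p\<close> is minimizing.\<close>

definition tangent_cut_locus ::
    "('a::topological_space, 'e::euclidean_space) rmanifold \<Rightarrow> 'a \<Rightarrow> 'e set" where
  "tangent_cut_locus M p =
     {v. minimizing_upto M p v 1 \<and> \<not> (\<exists>b>1. minimizing_upto M p v b)}"

definition cut_locus ::
    "('a::topological_space, 'e::euclidean_space) rmanifold \<Rightarrow> 'a \<Rightarrow> 'a set" where
  "cut_locus M p = rexp M p ` tangent_cut_locus M p"

text \<open>The logarithm is the inverse of the exponential map on the injectivity domain, whose image
  is the complement of the cut locus. Outside that image it is undefined; as a total function it
  has the dummy value \<open>0\<close> there.\<close>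

definition rlog ::
    "('a::topological_space, 'e::euclidean_space) rmanifold \<Rightarrow> 'a \<Rightarrow> 'a \<Rightarrow> 'e" where
  "rlog M p x =
     (if x \<in> rexp M p ` injectivity_domain M p
      then inv_into (injectivity_domain M p) (rexp M p) x else 0)"


subsection \<open>Riemannian product\<close>

definition rprod :: "('a, 'e) rmanifold \<Rightarrow> ('b, 'f) rmanifold \<Rightarrow> ('a \<times> 'b, 'e \<times> 'f) rmanifold"
    (infixr \<open>\<otimes>\<^sub>R\<close> 80) where
  "M \<otimes>\<^sub>R N =
     \<lparr>chart_dom = (\<lambda>(p, q). chart_dom M p \<times> chart_dom N q),
      chart = (\<lambda>(p, q) (x, y). (chart M p x, chart N q y)),
      metric = (\<lambda>(p, q) (u, w) (u', w'). metric M p u u' + metric N q w w')\<rparr>"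


section \<open>Weighted product medians\<close>

definition dist_alpha ::
    "('a::topological_space, 'e::euclidean_space) rmanifold \<Rightarrow>
     ('b::topological_space, 'f::euclidean_space) rmanifold \<Rightarrow>
     real \<Rightarrow> 'a \<times> 'b \<Rightarrow> 'a \<times> 'b \<Rightarrow> real" where
  "dist_alpha M N \<alpha> m z =
     sqrt (\<alpha> * (gdist M (fst m) (fst z))\<^sup>2 + (2 - \<alpha>) * (gdist N (snd m) (snd z))\<^sup>2)"

definition plog ::
    "('a::topological_space, 'e::euclidean_space) rmanifold \<Rightarrow>
     ('b::topological_space, 'f::euclidean_space) rmanifold \<Rightarrow>
     'a \<times> 'b \<Rightarrow> 'a \<times> 'b \<Rightarrow> 'e \<times> 'f" where
  "plog M N m z = (rlog M (fst m) (fst z), rlog N (snd m) (snd z))"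

definition score ::
    "('a::topological_space, 'e::euclidean_space) rmanifold \<Rightarrow>
     ('b::topological_space, 'f::euclidean_space) rmanifold \<Rightarrow>
     real \<Rightarrow> 'a \<times> 'b \<Rightarrow> 'a \<times> 'b \<Rightarrow> 'e \<times> 'f" where
  "score M N \<alpha> z m = (1 / dist_alpha M N \<alpha> m z) *\<^sub>R plog M N m z"

definition score_domain ::
    "('a::topological_space, 'e::euclidean_space) rmanifold \<Rightarrow>
     ('b::topological_space, 'f::euclidean_space) rmanifold \<Rightarrow>
     'a \<times> 'b \<Rightarrow> ('a \<times> 'b) set" where
  "score_domain M N m = - (cut_locus (M \<otimes>\<^sub>R N) m \<union> {m})"

text \<open>Here \<open>\<nu>\<close> is the law of the random element. The expectation is over the set of points
  where the score is defined.\<close>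

definition mean_score ::
    "('a::topological_space, 'e::euclidean_space) rmanifold \<Rightarrow>
     ('b::topological_space, 'f::euclidean_space) rmanifold \<Rightarrow>
     ('a \<times> 'b) measure \<Rightarrow> real \<Rightarrow> 'a \<times> 'b \<Rightarrow> 'e \<times> 'f" where
  "mean_score M N \<nu> \<alpha> m = (LINT z:score_domain M N m|\<nu>. score M N \<alpha> z m)"

text \<open>Differentiability of \<open>(\<alpha>, m) \<mapsto> G \<alpha> m\<close>, a family of vector fields, at all points of a
  neighbourhood of \<open>(\<alpha>\<^sub>0, m\<^sub>0)\<close>, expressed in the chart at \<open>m\<^sub>0\<close>.\<close>

definition differentiable_family_near ::
    "('a, 'e::euclidean_space) rmanifold \<Rightarrow> (real \<Rightarrow> 'a \<Rightarrow> 'e) \<Rightarrow> real \<Rightarrow> 'a \<Rightarrow> bool" where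
  "differentiable_family_near M G \<alpha>\<^sub>0 m\<^sub>0 \<longleftrightarrow>
     (\<exists>W. open W \<and> (\<alpha>\<^sub>0, chart M m\<^sub>0 m\<^sub>0) \<in> W \<and> W \<subseteq> UNIV \<times> chart_img M m\<^sub>0 \<and>
        (\<forall>w\<in>W. (\<lambda>(\<alpha>, x). field_coords M m\<^sub>0 (G \<alpha>) x) differentiable (at w)))"


section \<open>Medians and empirical laws\<close>

text \<open>Expected distances are extended nonnegative reals, so no integrability is presupposed.\<close>

definition is_geometric_median :: "('a \<Rightarrow> 'a \<Rightarrow> real) \<Rightarrow> 'a measure \<Rightarrow> 'a \<Rightarrow> bool" where
  "is_geometric_median d \<nu> p \<longleftrightarrow> is_arg_min (\<lambda>p. \<integral>\<^sup>+x. ennreal (d p x) \<partial>\<nu>) (\<lambda>_. True) p"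

definition is_median :: "real measure \<Rightarrow> real \<Rightarrow> bool" where
  "is_median \<nu> s \<longleftrightarrow> measure \<nu> {..s} \<ge> 1 / 2 \<and> measure \<nu> {s..} \<ge> 1 / 2"

definition empirical :: "nat \<Rightarrow> (nat \<Rightarrow> 'a) \<Rightarrow> 'a measure" where
  "empirical n x = measure_pmf (map_pmf x (pmf_of_set {..<n}))"

definition oP1 :: "'w measure \<Rightarrow> (nat \<Rightarrow> 'w \<Rightarrow> real) \<Rightarrow> bool" where
  "oP1 P R \<longleftrightarrow> (\<forall>\<eta>>0. (\<lambda>n. measure P {\<omega>\<in>space P. \<bar>R n \<omega>\<bar> > \<eta>}) \<longlonglongrightarrow> 0)"

end

theory Submission
  imports Defs
begin

text \<open>
  The identity \<open>\<parallel>log\<^sub>p x\<parallel> = d(p, x)\<close> on both factors and \<open>\<alpha>, 2 - \<alpha> \<ge> \<epsilon>\<close> give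
  \<open>d\<^sub>\<alpha>\<^sup>2 \<ge> \<epsilon> \<parallel>log\<parallel>\<^sup>2\<close>, hence the bound on the score. The covariant derivative of a
  differentiable field is linear, because the Koszul formula is linear in the direction; so
  \<open>A\<^sub>0\<^sup>-\<^sup>1\<close> is a linear map of a finite-dimensional space and preserves boundedness.
\<close>

section \<open>Positive definite forms on Euclidean spaces\<close>

lemma bilinear_zero_of_Basis:
  fixes B :: "'e::euclidean_space \<Rightarrow> 'e \<Rightarrow> real"
  assumes "bilinear B" "\<And>b. b \<in> Basis \<Longrightarrow> B k b = 0"
  shows "B k w = 0"
proof -
  have lin: "linear (B k)"
    using assms(1) by (simp add: bilinear_def)
  have "B k w = B k (\<Sum>b\<in>Basis. (w \<bullet> b) *\<^sub>R b)"
    by (simp add: euclidean_representation)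
  also have "\<dots> = (\<Sum>b\<in>Basis. (w \<bullet> b) * B k b)"
    by (simp add: linear_sum[OF lin] linear_cmul[OF lin])
  finally show ?thesis
    using assms(2) by simp
qed

text \<open>Riesz representation in finite dimension: positive definiteness makes the passage from
  vectors to functionals injective, hence bijective. It gives the definite description in
  \<open>christoffel\<close> a unique solution.\<close>

lemma pos_def_represents_functional:
  fixes B :: "'e::euclidean_space \<Rightarrow> 'e \<Rightarrow> real"
  assumes B: "bilinear B" and pos: "\<And>u. u \<noteq> 0 \<Longrightarrow> B u u > 0" and L: "linear L"
  shows "\<exists>!k. \<forall>w. B k w = L w"
proof -
  have linl: "linear (\<lambda>k. B k w)" and linr: "linear (B k)" for k w
    using B by (simp_all add: bilinear_def)
  have ext: "\<forall>w. f w = g w"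
    if "linear f" "linear g" "\<And>b. b \<in> Basis \<Longrightarrow> f b = g b" for f g :: "'e \<Rightarrow> real"
    using linear_eq_stdbasis[OF that] by simp
  \<comment> \<open>\<open>T k\<close> encodes the functional \<open>B k\<close> by its values on
    the basis, which makes it an endomorphism of the same space.\<close>
  define T where "T k = (\<Sum>b\<in>Basis. B k b *\<^sub>R b)" for k
  have T_inner: "T k \<bullet> b = B k b" if "b \<in> Basis" for k b
    using that by (simp add: T_def)
  have T: "linear T"
    unfolding T_def
    by (intro linearI)
      (simp_all add: linear_add[OF linl] linear_cmul[OF linl] scaleR_add_left sum.distrib
        scaleR_sum_right)
  have zero: "k = 0" if "\<And>b. b \<in> Basis \<Longrightarrow> B k b = 0" for k
    using bilinear_zero_of_Basis[OF B that, of k] pos[of k] by force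
  \<comment> \<open>If \<open>T k = 0\<close>, then \<open>B k\<close> vanishes on the basis, so
    \<open>B k k = 0\<close> and positivity forces \<open>k = 0\<close>.\<close>
  have "inj T"
    unfolding linear_injective_0[OF T] using T_inner zero by (metis inner_zero_left)
  then have "surj T"
    using T linear_injective_imp_surjective by blast
  then obtain k where k: "T k = (\<Sum>b\<in>Basis. L b *\<^sub>R b)"
    by (metis surjD)
  have kb: "B k b = L b" if "b \<in> Basis" for b
    using T_inner[OF that, of k] that by (simp add: k)
  show ?thesis
  proof (rule ex1I[of _ k])
    show "\<forall>w. B k w = L w"
      using ext[OF linr L] kb by blast
    fix j assume j: "\<forall>w. B j w = L w"
    have "B (j - k) b = 0" if "b \<in> Basis" for b
      using linear_diff[OF linl, of j k b] j kb[OF that] by simp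
    then show "j = k"
      using zero[of "j - k"] by simp
  qed
qed

text \<open>By compactness the quadratic form attains its minimum on the unit sphere. That minimum
  is positive, and homogeneity extends the bound to all vectors, with its square root as
  \<open>c\<close>.\<close>

lemma pos_def_coercive:
  fixes B :: "'e::euclidean_space \<Rightarrow> 'e \<Rightarrow> real"
  assumes B: "bilinear B" and pos: "\<And>u. u \<noteq> 0 \<Longrightarrow> B u u > 0"
  obtains c where "c > 0" "\<And>v. c * norm v \<le> sqrt (B v v)"
proof -
  have bb: "bounded_bilinear B"
    using B bilinear_conv_bounded_bilinear by blast
  have "continuous_on (sphere 0 1) (\<lambda>v. B v v)"
    by (intro bounded_bilinear.continuous_on[OF bb] continuous_on_id)
  moreover have "sphere (0::'e) 1 \<noteq> {}"
    by simp
  ultimately obtain x where x: "x \<in> sphere 0 1" "\<And>y. y \<in> sphere 0 1 \<Longrightarrow> B x x \<le> B y y"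
    using continuous_attains_inf[OF compact_sphere] by blast
  have Bx: "B x x > 0"
    using x(1) by (intro pos) auto
  have "sqrt (B x x) * norm v \<le> sqrt (B v v)" for v
  proof (cases "v = 0")
    case True
    then show ?thesis
      using bounded_bilinear.zero_left[OF bb] by simp
  next
    case False
    have "B x x \<le> B (v /\<^sub>R norm v) (v /\<^sub>R norm v)"
      using False by (intro x(2)) simp
    also have "\<dots> = B v v / (norm v)\<^sup>2"
      by (simp add: bounded_bilinear.scaleR_left[OF bb] bounded_bilinear.scaleR_right[OF bb]
          power2_eq_square divide_simps)
    finally have "B x x * (norm v)\<^sup>2 \<le> B v v"
      using False by (simp add: pos_le_divide_eq)
    then have "sqrt (B x x * (norm v)\<^sup>2) \<le> sqrt (B v v)"
      by simp
    then show ?thesis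
      by (simp add: real_sqrt_mult)
  qed
  with that[of "sqrt (B x x)"] Bx show thesis
    by simp
qed

text \<open>Continuity of the form bounds \<open>B v v\<close> by a multiple of the squared norm.
  Together with coercivity this makes the Riemannian norm at a point equivalent to the Euclidean
  norm of the model space.\<close>

lemma bilinear_sqrt_bound:
  fixes B :: "'e::euclidean_space \<Rightarrow> 'e \<Rightarrow> real"
  assumes "bilinear B"
  obtains K where "K \<ge> 0" "\<And>v. sqrt (B v v) \<le> K * norm v"
proof -
  have bb: "bounded_bilinear B"
    using assms bilinear_conv_bounded_bilinear by blast
  obtain K where K: "K \<ge> 0" "\<And>v w. norm (B v w) \<le> norm v * norm w * K"
    using bounded_bilinear.nonneg_bounded[OF bb] by blast
  have "sqrt (B v v) \<le> sqrt K * norm v" for v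
  proof -
    have "B v v \<le> K * (norm v)\<^sup>2"
      using K(2)[of v v] by (simp add: power2_eq_square mult_ac)
    then have "sqrt (B v v) \<le> sqrt (K * (norm v)\<^sup>2)"
      by (rule real_sqrt_le_mono)
    then show ?thesis
      by (simp add: real_sqrt_mult)
  qed
  with that[of "sqrt K"] K(1) show thesis
    by simp
qed

section \<open>Linearity of the covariant derivative\<close>

text \<open>Derivatives are local, so the identity is asked for only on an open set around
  \<open>x\<close>. For metric coefficients this set is the chart image, outside which
  \<open>chart_inv\<close> has arbitrary values.\<close>

lemma frechet_derivative_linear_combination:
  fixes f g h :: "'e::euclidean_space \<Rightarrow> real"
  assumes "open S" "x \<in> S" "g differentiable (at x)" "h differentiable (at x)"
    and "\<And>y. y \<in> S \<Longrightarrow> f y = a * g y + b * h y"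
  shows "frechet_derivative f (at x) v =
    a * frechet_derivative g (at x) v + b * frechet_derivative h (at x) v"
proof -
  have "((\<lambda>y. a * g y + b * h y) has_derivative
      (\<lambda>v. a * frechet_derivative g (at x) v + b * frechet_derivative h (at x) v)) (at x)"
    using assms(3,4) unfolding frechet_derivative_works
    by (intro has_derivative_add has_derivative_mult_right)
  then have "(f has_derivative
      (\<lambda>v. a * frechet_derivative g (at x) v + b * frechet_derivative h (at x) v)) (at x)"
    by (rule has_derivative_transform_within_open[OF _ assms(1,2)]) (simp add: assms(5))
  then show ?thesis
    by (metis frechet_derivative_at)
qed

text \<open>For fixed \<open>v\<close>, the right-hand side of the Koszul formula is linear in
  \<open>u\<close>, and the representing vector inherits linearity by uniqueness. The hypotheses are
  local, so that they can be checked for a product directly from its factors.\<close>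

lemma linear_christoffel:
  fixes M :: "('a, 'e::euclidean_space) rmanifold"
  assumes S: "open S" "x \<in> S"
    and bil: "\<And>y. y \<in> S \<Longrightarrow> bilinear (metric_coeff M c y)"
    and diff: "\<And>u w. (\<lambda>y. metric_coeff M c y u w) differentiable (at x)"
    and pos: "\<And>u. u \<noteq> 0 \<Longrightarrow> metric_coeff M c x u u > 0"
  shows "linear (\<lambda>u. christoffel M c x u v)"
proof -
  let ?g = "\<lambda>u w y. metric_coeff M c y u w"
  define D where "D u w h = frechet_derivative (?g u w) (at x) h" for u w h
  \<comment> \<open>The right-hand side of the Koszul formula, with \<open>v\<close> fixed.\<close>
  define R where "R u w = D v w u + D u w v - D u v w" for u w
  have D1: "D (a *\<^sub>R u + b *\<^sub>R u') w h = a * D u w h + b * D u' w h" for a b u u' w h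
    unfolding D_def
    by (rule frechet_derivative_linear_combination[OF S diff diff])
      (use bil in \<open>simp add: bilinear_ladd bilinear_lmul\<close>)
  have D2: "D u (a *\<^sub>R w + b *\<^sub>R w') h = a * D u w h + b * D u w' h" for a b u w w' h
    unfolding D_def
    by (rule frechet_derivative_linear_combination[OF S diff diff])
      (use bil in \<open>simp add: bilinear_radd bilinear_rmul\<close>)
  have D3: "D u w (a *\<^sub>R h + b *\<^sub>R h') = a * D u w h + b * D u w h'" for a b u w h h'
    using linear_frechet_derivative[OF diff, of u w] unfolding D_def
    by (simp add: linear_add linear_cmul)
  \<comment> \<open>Linearity in \<open>u\<close> will give the conclusion; linearity in
    \<open>w\<close>, proved next, makes \<open>R u\<close> a functional that the metric can
    represent.\<close>
  have R1: "R (a *\<^sub>R u + b *\<^sub>R u') w = a * R u w + b * R u' w" for a b u u' w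
    unfolding R_def D1 D3 by (simp add: algebra_simps)
  have R2: "R u (a *\<^sub>R w + b *\<^sub>R w') = a * R u w + b * R u w'" for a b u w w'
    unfolding R_def D2 D3 by (simp add: algebra_simps)
  let ?B = "metric_coeff M c x"
  have ex: "\<exists>!k. \<forall>w. 2 * ?B k w = R u w" for u
  proof -
    \<comment> \<open>Halving absorbs the factor 2 of the Koszul formula.\<close>
    have "linear (\<lambda>w. R u w / 2)"
      using R2[of u 1 _ 1] R2[of u _ _ 0] by (intro linearI) (simp_all add: add_divide_distrib)
    from pos_def_represents_functional[OF bil[OF S(2)] pos this] show ?thesis
      by (simp add: field_simps)
  qed
  \<comment> \<open>Unique existence turns the definite description into the Koszul equation
    itself.\<close>
  have spec: "2 * ?B (christoffel M c x u v) w = R u w" for u w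
    using theI'[OF ex[of u]] unfolding christoffel_def R_def D_def by blast
  have uniq: "k = christoffel M c x u v" if "\<And>w. 2 * ?B k w = R u w" for k u
    using ex[of u] spec[of u] that by blast
  \<comment> \<open>The combination of the two Christoffel vectors solves the Koszul equation for
    the combined direction, so uniqueness identifies it.\<close>
  have comb: "a *\<^sub>R christoffel M c x u v + b *\<^sub>R christoffel M c x u' v
      = christoffel M c x (a *\<^sub>R u + b *\<^sub>R u') v" for a b u u'
  proof (rule uniq)
    fix w
    show "2 * ?B (a *\<^sub>R christoffel M c x u v + b *\<^sub>R christoffel M c x u' v) w
        = R (a *\<^sub>R u + b *\<^sub>R u') w"
      unfolding R1 bilinear_ladd[OF bil[OF S(2)]] bilinear_lmul[OF bil[OF S(2)]]
        spec[of u w, symmetric] spec[of u' w, symmetric]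
      by (simp add: algebra_simps)
  qed
  show ?thesis
    \<comment> \<open>Coefficients 1 and 1 give additivity; a vanishing second coefficient gives
      homogeneity.\<close>
    using comb[of 1 _ 1] comb[of _ _ 0] by (intro linearI) simp_all
qed

text \<open>The coordinate derivative and the Christoffel correction are each linear in the
  direction.\<close>

lemma linear_cov_deriv:
  fixes M :: "('a, 'e::euclidean_space) rmanifold"
  assumes "field_coords M p V differentiable (at (chart M p p))"
    and "linear (\<lambda>u. christoffel M p (chart M p p) u (V p))"
  shows "linear (cov_deriv M V p)"
proof -
  have "linear (\<lambda>w. frechet_derivative (field_coords M p V) (at (chart M p p)) w
      + christoffel M p (chart M p p) w (V p))"
    by (intro linear_compose_add linear_frechet_derivative assms)
  then show ?thesis
    by (simp add: cov_deriv_def[abs_def])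
qed

section \<open>Charts and metric coefficients\<close>

lemma smooth_on_imp_differentiable:
  "smooth_on S f \<Longrightarrow> x \<in> S \<Longrightarrow> f differentiable (at x)"
  unfolding smooth_on_def by (metis Ck_on.simps(2))

context
  fixes M :: "('a::{t2_space,second_countable_topology}, 'e::euclidean_space) rmanifold"
  assumes M: "riemannian_manifold M"
begin

lemma riemannian_smooth_atlas: "smooth_atlas M"
  using M by (simp add: riemannian_manifold_def)

lemma bilinear_metric: "bilinear (metric M p)"
  and metric_pos: "u \<noteq> 0 \<Longrightarrow> metric M p u u > 0"
  using M by (auto simp: riemannian_manifold_def)

lemma center_in_chart_dom: "c \<in> chart_dom M c"
  and open_chart_img: "open (chart_img M c)"
  and inj_on_chart: "inj_on (chart M c) (chart_dom M c)"
  using riemannian_smooth_atlas unfolding smooth_atlas_def homeomorphism_def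
  by (blast, blast, metis inj_on_inverseI)

lemma center_in_chart_img: "chart M c c \<in> chart_img M c"
  using center_in_chart_dom by (simp add: chart_img_def)

lemma chart_inv_in_dom: "x \<in> chart_img M c \<Longrightarrow> chart_inv M c x \<in> chart_dom M c"
  and chart_chart_inv: "x \<in> chart_img M c \<Longrightarrow> chart M c (chart_inv M c x) = x"
  by (auto simp: chart_inv_def chart_img_def inv_into_into f_inv_into_f)

lemma chart_inv_chart: "y \<in> chart_dom M c \<Longrightarrow> chart_inv M c (chart M c y) = y"
  using inj_on_chart by (simp add: chart_inv_def)

text \<open>Each point lies in the domain of its own chart, so \<open>x\<close> belongs to the
  overlap on which this transition map is smooth. Its derivative is the Jacobian in
  \<open>metric_coeff\<close>.\<close>

lemma transition_differentiable:
  assumes "x \<in> chart_img M c"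
  shows "transition M c (chart_inv M c x) differentiable (at x)"
proof -
  let ?p = "chart_inv M c x"
  have "x \<in> chart M c ` (chart_dom M c \<inter> chart_dom M ?p)"
    using chart_inv_in_dom[OF assms] chart_chart_inv[OF assms] center_in_chart_dom
    by (metis IntI imageI)
  moreover have "smooth_on (chart M c ` (chart_dom M c \<inter> chart_dom M ?p)) (transition M c ?p)"
    using riemannian_smooth_atlas by (simp add: smooth_atlas_def)
  ultimately show ?thesis
    using smooth_on_imp_differentiable by blast
qed

lemma metric_coeff_differentiable:
  "x \<in> chart_img M c \<Longrightarrow> (\<lambda>x. metric_coeff M c x u w) differentiable (at x)"
  using M smooth_on_imp_differentiable unfolding riemannian_manifold_def by blast

text \<open>The coefficients are the pullback of a bilinear form by the Jacobian, which is linear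
  because the transition map is differentiable at \<open>x\<close>.\<close>

lemma bilinear_metric_coeff:
  assumes "x \<in> chart_img M c"
  shows "bilinear (metric_coeff M c x)"
proof -
  note lin = linear_frechet_derivative[OF transition_differentiable[OF assms]]
  note B = bilinear_metric[of "chart_inv M c x"]
  show ?thesis
    unfolding bilinear_def metric_coeff_def Let_def
    by (auto intro!: linearI simp: linear_add[OF lin] linear_cmul[OF lin]
        bilinear_ladd[OF B] bilinear_radd[OF B] bilinear_lmul[OF B] bilinear_rmul[OF B])
qed

text \<open>Near its centre the transition from a chart to itself is the identity, so the Jacobian
  there is the identity too. This transfers positivity from the metric to its coefficients.\<close>

lemma metric_coeff_center: "metric_coeff M c (chart M c c) u w = metric M c u w"
proof -
  have "(transition M c c has_derivative (\<lambda>h. h)) (at (chart M c c))"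
    by (rule has_derivative_transform_within_open[OF has_derivative_ident
          open_chart_img center_in_chart_img])
      (simp add: transition_def chart_chart_inv)
  then have "frechet_derivative (transition M c c) (at (chart M c c)) = (\<lambda>h. h)"
    by (rule frechet_derivative_at[symmetric])
  then show ?thesis
    by (simp add: metric_coeff_def Let_def chart_inv_chart center_in_chart_dom)
qed

section \<open>Length of the logarithm\<close>

lemma tnorm_sq: "(tnorm M p v)\<^sup>2 = metric M p v v"
  using metric_pos[of v p] bilinear_lzero[OF bilinear_metric[of p], of 0]
  by (cases "v = 0") (simp_all add: tnorm_def)

text \<open>Squares are needed because \<open>gdist\<close> has an unspecified value if no curve joins the points.\<close>

lemma tnorm_rlog_le: "(tnorm M p (rlog M p x))\<^sup>2 \<le> (gdist M p x)\<^sup>2"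
proof (cases "x \<in> rexp M p ` injectivity_domain M p")
  case True
  let ?v = "inv_into (injectivity_domain M p) (rexp M p) x"
  have "?v \<in> injectivity_domain M p" "rexp M p ?v = x"
    using True by (auto simp: inv_into_into f_inv_into_f)
  then obtain b where "b > 1" "minimizing_upto M p ?v b"
    by (auto simp: injectivity_domain_def)
  \<comment> \<open>The geodesic minimizes beyond time 1, so its time-1 endpoint \<open>x\<close> is
    at distance equal to the length of the initial velocity.\<close>
  then have "gdist M p (rexp M p (1 *\<^sub>R ?v)) = 1 * tnorm M p ?v"
    unfolding minimizing_upto_def by (metis atLeastAtMost_iff less_eq_real_def zero_le_one)
  with True \<open>rexp M p ?v = x\<close> show ?thesis
    by (simp add: rlog_def)
next
  case False
  \<comment> \<open>Here \<open>rlog\<close> has its dummy value 0 and the left-hand side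
    vanishes.\<close>
  then show ?thesis
    using bilinear_lzero[OF bilinear_metric[of p], of 0] by (simp add: rlog_def tnorm_sq)
qed

end

section \<open>Riemannian products\<close>

lemma rprod_sel [simp]:
  "chart_dom (M \<otimes>\<^sub>R N) c = chart_dom M (fst c) \<times> chart_dom N (snd c)"
  "chart (M \<otimes>\<^sub>R N) c z = (chart M (fst c) (fst z), chart N (snd c) (snd z))"
  "metric (M \<otimes>\<^sub>R N) c u w = metric M (fst c) (fst u) (fst w) + metric N (snd c) (snd u) (snd w)"
  by (simp_all add: rprod_def split: prod.splits)

lemma chart_img_rprod:
  "chart_img (M \<otimes>\<^sub>R N) c = chart_img M (fst c) \<times> chart_img N (snd c)"
  unfolding chart_img_def by (auto simp: image_iff)

context
  fixes M :: "('a::{t2_space,second_countable_topology}, 'e::euclidean_space) rmanifold"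
    and N :: "('b::{t2_space,second_countable_topology}, 'f::euclidean_space) rmanifold"
  assumes M: "riemannian_manifold M" and N: "riemannian_manifold N"
begin

text \<open>The pair of inverse charts is a preimage of \<open>x\<close> in the product domain, and
  the product chart is injective there.\<close>

lemma chart_inv_rprod:
  assumes "x \<in> chart_img (M \<otimes>\<^sub>R N) c"
  shows "chart_inv (M \<otimes>\<^sub>R N) c x = (chart_inv M (fst c) (fst x), chart_inv N (snd c) (snd x))"
proof -
  have "inj_on (chart (M \<otimes>\<^sub>R N) c) (chart_dom (M \<otimes>\<^sub>R N) c)"
    using inj_on_chart[OF M] inj_on_chart[OF N] by (auto simp: inj_on_def)
  then show ?thesis
    unfolding chart_inv_def[of "M \<otimes>\<^sub>R N"] using assms
    by (intro inv_into_f_eq)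
      (auto simp: chart_img_rprod chart_inv_in_dom[OF M] chart_inv_in_dom[OF N]
        chart_chart_inv[OF M] chart_chart_inv[OF N])
qed

lemma open_chart_img_rprod: "open (chart_img (M \<otimes>\<^sub>R N) c)"
  unfolding chart_img_rprod by (intro open_Times open_chart_img M N)

text \<open>The transition map of the product acts componentwise, so its Jacobian is block diagonal
  and the pulled-back metric has no mixed terms.\<close>

lemma metric_coeff_rprod:
  assumes x: "x \<in> chart_img (M \<otimes>\<^sub>R N) c"
  shows "metric_coeff (M \<otimes>\<^sub>R N) c x u w =
    metric_coeff M (fst c) (fst x) (fst u) (fst w) + metric_coeff N (snd c) (snd x) (snd u) (snd w)"
proof -
  let ?p = "chart_inv M (fst c) (fst x)" and ?q = "chart_inv N (snd c) (snd x)"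
  let ?f = "transition M (fst c) ?p" and ?g = "transition N (snd c) ?q"
  have x': "fst x \<in> chart_img M (fst c)" "snd x \<in> chart_img N (snd c)"
    using x by (auto simp: chart_img_rprod)
  have "(?f has_derivative frechet_derivative ?f (at (fst x))) (at (fst x))"
    "(?g has_derivative frechet_derivative ?g (at (snd x))) (at (snd x))"
    using transition_differentiable[OF M x'(1)] transition_differentiable[OF N x'(2)]
    by (simp_all add: frechet_derivative_works)
  then have "((\<lambda>z. (?f (fst z), ?g (snd z))) has_derivative
      (\<lambda>h. (frechet_derivative ?f (at (fst x)) (fst h), frechet_derivative ?g (at (snd x)) (snd h))))
      (at x)"
    by (intro has_derivative_Pair
        has_derivative_compose[OF has_derivative_fst[OF has_derivative_ident]]
        has_derivative_compose[OF has_derivative_snd[OF has_derivative_ident]])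
  then have "(transition (M \<otimes>\<^sub>R N) c (?p, ?q) has_derivative
      (\<lambda>h. (frechet_derivative ?f (at (fst x)) (fst h), frechet_derivative ?g (at (snd x)) (snd h))))
      (at x)"
    \<comment> \<open>The transition map agrees with the pair of transitions on the open chart
      image, which is enough for the derivative at \<open>x\<close>.\<close>
    by (rule has_derivative_transform_within_open[OF _ open_chart_img_rprod x])
      (simp add: transition_def chart_inv_rprod)
  then have "frechet_derivative (transition (M \<otimes>\<^sub>R N) c (?p, ?q)) (at x) =
      (\<lambda>h. (frechet_derivative ?f (at (fst x)) (fst h), frechet_derivative ?g (at (snd x)) (snd h)))"
    by (rule frechet_derivative_at[symmetric])
  then show ?thesis
    by (simp add: metric_coeff_def Let_def chart_inv_rprod[OF x])
qed

lemma bilinear_metric_rprod: "bilinear (metric (M \<otimes>\<^sub>R N) c)"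
  unfolding bilinear_def
  by (auto intro!: linearI simp: algebra_simps
      bilinear_ladd[OF bilinear_metric[OF M]] bilinear_radd[OF bilinear_metric[OF M]]
      bilinear_lmul[OF bilinear_metric[OF M]] bilinear_rmul[OF bilinear_metric[OF M]]
      bilinear_ladd[OF bilinear_metric[OF N]] bilinear_radd[OF bilinear_metric[OF N]]
      bilinear_lmul[OF bilinear_metric[OF N]] bilinear_rmul[OF bilinear_metric[OF N]])

lemma metric_rprod_pos:
  assumes "u \<noteq> 0"
  shows "metric (M \<otimes>\<^sub>R N) c u u > 0"
proof -
  have nonneg: "metric M (fst c) (fst u) (fst u) \<ge> 0" "metric N (snd c) (snd u) (snd u) \<ge> 0"
    by (simp_all flip: tnorm_sq[OF M] tnorm_sq[OF N])
  have "fst u \<noteq> 0 \<or> snd u \<noteq> 0"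
    using assms by (auto simp: prod_eq_iff)
  then show ?thesis
    using nonneg metric_pos[OF M, of "fst u" "fst c"] metric_pos[OF N, of "snd u" "snd c"] by force
qed

text \<open>Bilinearity and differentiability of the coefficients come from the two factors through
  the splitting of the metric.\<close>

lemma linear_christoffel_rprod:
  "linear (\<lambda>u. christoffel (M \<otimes>\<^sub>R N) c (chart (M \<otimes>\<^sub>R N) c c) u v)"
proof (rule linear_christoffel[OF open_chart_img_rprod])
  let ?x = "chart (M \<otimes>\<^sub>R N) c c"
  show x: "?x \<in> chart_img (M \<otimes>\<^sub>R N) c"
    by (simp add: chart_img_rprod center_in_chart_img[OF M] center_in_chart_img[OF N])
  show "bilinear (metric_coeff (M \<otimes>\<^sub>R N) c y)" if y: "y \<in> chart_img (M \<otimes>\<^sub>R N) c" for y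
  proof -
    have "bilinear (metric_coeff M (fst c) (fst y))" "bilinear (metric_coeff N (snd c) (snd y))"
      using y by (auto simp: chart_img_rprod intro!: bilinear_metric_coeff M N)
    note B = this
    show ?thesis
      unfolding bilinear_def metric_coeff_rprod[OF y, abs_def]
      by (auto intro!: linearI simp: metric_coeff_rprod[OF y] algebra_simps
          bilinear_ladd[OF B(1)] bilinear_radd[OF B(1)] bilinear_lmul[OF B(1)] bilinear_rmul[OF B(1)]
          bilinear_ladd[OF B(2)] bilinear_radd[OF B(2)] bilinear_lmul[OF B(2)] bilinear_rmul[OF B(2)])
  qed
  show "(\<lambda>y. metric_coeff (M \<otimes>\<^sub>R N) c y u w) differentiable (at ?x)" for u w
  proof -
    obtain D E where
      "((\<lambda>y. metric_coeff M (fst c) y (fst u) (fst w)) has_derivative D) (at (fst ?x))"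
      "((\<lambda>y. metric_coeff N (snd c) y (snd u) (snd w)) has_derivative E) (at (snd ?x))"
      using x metric_coeff_differentiable[OF M] metric_coeff_differentiable[OF N]
      unfolding chart_img_rprod differentiable_def mem_Times_iff by blast
    then have "((\<lambda>y. metric_coeff M (fst c) (fst y) (fst u) (fst w)
        + metric_coeff N (snd c) (snd y) (snd u) (snd w)) has_derivative
        (\<lambda>h. D (fst h) + E (snd h))) (at ?x)"
      by (intro has_derivative_add
          has_derivative_compose[OF has_derivative_fst[OF has_derivative_ident]]
          has_derivative_compose[OF has_derivative_snd[OF has_derivative_ident]])
    then have "((\<lambda>y. metric_coeff (M \<otimes>\<^sub>R N) c y u w) has_derivative
        (\<lambda>h. D (fst h) + E (snd h))) (at ?x)"
      by (rule has_derivative_transform_within_open[OF _ open_chart_img_rprod x])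
        (simp add: metric_coeff_rprod)
    then show ?thesis
      unfolding differentiable_def by blast
  qed
  show "metric_coeff (M \<otimes>\<^sub>R N) c ?x u u > 0" if "u \<noteq> 0" for u
    \<comment> \<open>At the centre of the chart the coefficients are the metric itself, so its
      positive definiteness applies.\<close>
    using metric_rprod_pos[OF that, of c] unfolding metric_coeff_rprod[OF x]
    by (simp add: metric_coeff_center[OF M] metric_coeff_center[OF N])
qed

section \<open>Uniform bound on the score\<close>

lemma tnorm_score_le:
  assumes "\<epsilon> > 0" "\<alpha> \<in> {\<epsilon>..2 - \<epsilon>}"
  shows "tnorm (M \<otimes>\<^sub>R N) m (score M N \<alpha> z m) \<le> 1 / sqrt \<epsilon>"
proof -
  let ?d = "gdist M (fst m) (fst z)" and ?e = "gdist N (snd m) (snd z)"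
  let ?l = "plog M N m z" and ?D = "dist_alpha M N \<alpha> m z"
  let ?L = "metric (M \<otimes>\<^sub>R N) m ?l ?l"
  have "?L \<le> ?d\<^sup>2 + ?e\<^sup>2"
    using tnorm_rlog_le[OF M, of "fst m" "fst z"] tnorm_rlog_le[OF N, of "snd m" "snd z"]
    by (simp add: plog_def tnorm_sq[OF M] tnorm_sq[OF N])
  then have "\<epsilon> * ?L \<le> \<epsilon> * ?d\<^sup>2 + \<epsilon> * ?e\<^sup>2"
    unfolding distrib_left[symmetric] using assms(1) by (intro mult_left_mono) auto
  \<comment> \<open>Membership of \<alpha> in the interval says exactly that both weights are at
    least \<epsilon>.\<close>
  also have "\<dots> \<le> \<alpha> * ?d\<^sup>2 + (2 - \<alpha>) * ?e\<^sup>2"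
    using assms(2) by (intro add_mono mult_right_mono) auto
  finally have "sqrt (\<epsilon> * ?L) \<le> ?D"
    unfolding dist_alpha_def by (rule real_sqrt_le_mono)
  then have le: "sqrt \<epsilon> * sqrt ?L \<le> ?D"
    by (simp only: real_sqrt_mult)
  \<comment> \<open>Both weights are nonnegative, so the radicand is as well. The sign lets the
    factor \<open>1 / ?D\<close> be taken out of the norm.\<close>
  have D: "?D \<ge> 0"
    using assms by (simp add: dist_alpha_def)
  have "metric (M \<otimes>\<^sub>R N) m (score M N \<alpha> z m) (score M N \<alpha> z m) = (1 / ?D)\<^sup>2 * ?L"
    unfolding score_def
    using bilinear_lmul[OF bilinear_metric_rprod] bilinear_rmul[OF bilinear_metric_rprod]
    by (simp only: power2_eq_square mult.assoc real_scaleR_def)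
  then have "tnorm (M \<otimes>\<^sub>R N) m (score M N \<alpha> z m) = sqrt ?L / ?D"
    unfolding tnorm_def using D by (simp add: real_sqrt_mult real_sqrt_divide del: rprod_sel)
  also have "\<dots> \<le> 1 / sqrt \<epsilon>"
    \<comment> \<open>If \<open>?D = 0\<close>, the quotient is 0 by the convention for division by
      zero.\<close>
    using le D assms(1) by (cases "?D = 0") (simp_all add: field_simps del: rprod_sel)
  finally show ?thesis .
qed

end

section \<open>Boundedness of the influence function\<close>

theorem mainTheorem16:
  fixes M :: "('a::{t2_space,second_countable_topology}, 'e::euclidean_space) rmanifold"
    and N :: "('b::{t2_space,second_countable_topology}, 'f::euclidean_space) rmanifold"
    and P :: "'w measure"
    and Z :: "'w \<Rightarrow> 'a \<times> 'b" and Zs :: "nat \<Rightarrow> 'w \<Rightarrow> 'a \<times> 'b"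
    and m :: "real \<Rightarrow> 'a \<times> 'b"
    and p\<^sub>0 :: 'a and q\<^sub>0 :: 'b and s\<^sub>M s\<^sub>N \<alpha>\<^sub>s\<^sub>c \<epsilon> :: real
    and phat :: "nat \<Rightarrow> 'w \<Rightarrow> 'a" and qhat :: "nat \<Rightarrow> 'w \<Rightarrow> 'b"
    and shat\<^sub>M shat\<^sub>N \<alpha>hat :: "nat \<Rightarrow> 'w \<Rightarrow> real"
    and \<phi> :: "'a \<times> 'b \<Rightarrow> real"
    and G :: "real \<Rightarrow> 'a \<times> 'b \<Rightarrow> 'e \<times> 'f"
    and m\<^sub>0 :: "'a \<times> 'b" and A\<^sub>0 :: "'e \<times> 'f \<Rightarrow> 'e \<times> 'f" and B\<^sub>0 :: "'e \<times> 'f"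
    and \<psi>\<^sub>0 IF\<^sub>s\<^sub>c :: "'a \<times> 'b \<Rightarrow> 'e \<times> 'f"
  assumes M: "complete_connected_riemannian_manifold M"
    and N: "complete_connected_riemannian_manifold N"
    and P: "prob_space P"
    and Z: "Z \<in> borel_measurable P"
    and p\<^sub>0: "is_geometric_median (gdist M) (distr P borel (\<lambda>\<omega>. fst (Z \<omega>))) p\<^sub>0"
    and q\<^sub>0: "is_geometric_median (gdist N) (distr P borel (\<lambda>\<omega>. snd (Z \<omega>))) q\<^sub>0"
    and s\<^sub>M: "is_median (distr P borel (\<lambda>\<omega>. gdist M p\<^sub>0 (fst (Z \<omega>)))) s\<^sub>M" "s\<^sub>M > 0"
    and s\<^sub>N: "is_median (distr P borel (\<lambda>\<omega>. gdist N q\<^sub>0 (snd (Z \<omega>)))) s\<^sub>N" "s\<^sub>N > 0"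
    and \<alpha>\<^sub>s\<^sub>c: "\<alpha>\<^sub>s\<^sub>c = 2 * s\<^sub>N\<^sup>2 / (s\<^sub>M\<^sup>2 + s\<^sub>N\<^sup>2)"
    and \<epsilon>: "0 < \<epsilon>" "\<epsilon> < 1" "\<alpha>\<^sub>s\<^sub>c \<in> {\<epsilon>..2 - \<epsilon>}"
    and m: "\<And>\<alpha> m'. \<alpha> \<in> {0<..<2} \<Longrightarrow>
              is_geometric_median (dist_alpha M N \<alpha>) (distr P borel Z) m' \<longleftrightarrow> m' = m \<alpha>"
    and iid: "prob_space.indep_vars P (\<lambda>_. borel) Zs UNIV"
             "\<And>i. distr P borel (Zs i) = distr P borel Z"
    and phat: "\<And>n \<omega>. n \<ge> 1 \<Longrightarrow> \<omega> \<in> space P \<Longrightarrow>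
              is_geometric_median (gdist M) (empirical n (\<lambda>i. fst (Zs i \<omega>))) (phat n \<omega>)"
    and qhat: "\<And>n \<omega>. n \<ge> 1 \<Longrightarrow> \<omega> \<in> space P \<Longrightarrow>
              is_geometric_median (gdist N) (empirical n (\<lambda>i. snd (Zs i \<omega>))) (qhat n \<omega>)"
    and shat\<^sub>M: "\<And>n \<omega>. n \<ge> 1 \<Longrightarrow> \<omega> \<in> space P \<Longrightarrow>
              is_median (empirical n (\<lambda>i. gdist M (phat n \<omega>) (fst (Zs i \<omega>)))) (shat\<^sub>M n \<omega>)"
    and shat\<^sub>N: "\<And>n \<omega>. n \<ge> 1 \<Longrightarrow> \<omega> \<in> space P \<Longrightarrow>
              is_median (empirical n (\<lambda>i. gdist N (qhat n \<omega>) (snd (Zs i \<omega>)))) (shat\<^sub>N n \<omega>)"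
    and \<alpha>hat: "\<And>n \<omega>. \<alpha>hat n \<omega> = 2 * (shat\<^sub>N n \<omega>)\<^sup>2 / ((shat\<^sub>M n \<omega>)\<^sup>2 + (shat\<^sub>N n \<omega>)\<^sup>2)"
              "\<And>n. \<alpha>hat n \<in> borel_measurable P"
    and \<phi>: "\<phi> \<in> borel_measurable borel" "integrable P (\<lambda>\<omega>. (\<phi> (Z \<omega>))\<^sup>2)"
           "prob_space.expectation P (\<lambda>\<omega>. \<phi> (Z \<omega>)) = 0"
           "oP1 P (\<lambda>n \<omega>. sqrt (real n) * (\<alpha>hat n \<omega> - \<alpha>\<^sub>s\<^sub>c)
                          - (1 / sqrt (real n)) * (\<Sum>i<n. \<phi> (Zs i \<omega>)))"
    and G: "G = mean_score M N (distr P borel Z)"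
    and m\<^sub>0: "m\<^sub>0 = m \<alpha>\<^sub>s\<^sub>c"
    and G_diff: "differentiable_family_near (M \<otimes>\<^sub>R N) G \<alpha>\<^sub>s\<^sub>c m\<^sub>0"
    and A\<^sub>0: "A\<^sub>0 = cov_deriv (M \<otimes>\<^sub>R N) (G \<alpha>\<^sub>s\<^sub>c) m\<^sub>0"
    and B\<^sub>0: "B\<^sub>0 = vector_derivative (\<lambda>\<alpha>. G \<alpha> m\<^sub>0) (at \<alpha>\<^sub>s\<^sub>c)"
    and \<psi>\<^sub>0: "\<And>z. \<psi>\<^sub>0 z = score M N \<alpha>\<^sub>s\<^sub>c z m\<^sub>0"
    and IF\<^sub>s\<^sub>c: "\<And>z. IF\<^sub>s\<^sub>c z = - inv A\<^sub>0 (\<psi>\<^sub>0 z + \<phi> z *\<^sub>R B\<^sub>0)"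
  shows "(\<forall>z. z \<notin> cut_locus (M \<otimes>\<^sub>R N) m\<^sub>0 \<union> {m\<^sub>0} \<longrightarrow>
            tnorm (M \<otimes>\<^sub>R N) m\<^sub>0 (\<psi>\<^sub>0 z) \<le> 1 / sqrt \<epsilon>) \<and>
         (bounded (range \<phi>) \<and> bij A\<^sub>0 \<longrightarrow>
            (\<exists>C. \<forall>z. z \<notin> cut_locus (M \<otimes>\<^sub>R N) m\<^sub>0 \<union> {m\<^sub>0} \<longrightarrow>
               tnorm (M \<otimes>\<^sub>R N) m\<^sub>0 (IF\<^sub>s\<^sub>c z) \<le> C))"
proof -
  have M': "riemannian_manifold M" and N': "riemannian_manifold N"
    using M N by (simp_all add: complete_connected_riemannian_manifold_def)
  let ?T = "tnorm (M \<otimes>\<^sub>R N) m\<^sub>0"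
  have score_bound: "?T (\<psi>\<^sub>0 z) \<le> 1 / sqrt \<epsilon>" for z
    unfolding \<psi>\<^sub>0 by (rule tnorm_score_le[OF M' N' \<epsilon>(1,3)])
  have "\<exists>C. \<forall>z. ?T (IF\<^sub>s\<^sub>c z) \<le> C" if bd: "bounded (range \<phi>)" and bij: "bij A\<^sub>0"
  proof -
    note B = bilinear_metric_rprod[OF M' N', of m\<^sub>0]
    let ?x = "chart (M \<otimes>\<^sub>R N) m\<^sub>0 m\<^sub>0"
    have "(\<lambda>(\<alpha>, x). field_coords (M \<otimes>\<^sub>R N) m\<^sub>0 (G \<alpha>) x) differentiable (at (\<alpha>\<^sub>s\<^sub>c, ?x))"
      using G_diff unfolding differentiable_family_near_def by blast
    \<comment> \<open>Joint differentiability is restricted to the slice of constant \<alpha>, since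
      the covariant derivative acts in the manifold variable only.\<close>
    moreover have "(\<lambda>x. (\<alpha>\<^sub>s\<^sub>c, x)) differentiable (at ?x)"
      by (rule differentiableI[OF has_derivative_Pair[OF has_derivative_const has_derivative_ident]])
    ultimately have "(\<lambda>(\<alpha>, x). field_coords (M \<otimes>\<^sub>R N) m\<^sub>0 (G \<alpha>) x) \<circ> (\<lambda>x. (\<alpha>\<^sub>s\<^sub>c, x))
        differentiable (at ?x)"
      by (intro differentiable_chain_at)
    then have "linear A\<^sub>0"
      unfolding A\<^sub>0 by (intro linear_cov_deriv linear_christoffel_rprod M' N') (simp add: o_def)
    then have lin: "linear (inv A\<^sub>0)"
      using bij by (metis bij_is_inj bij_is_surj inj_linear_imp_inv_linear)
    \<comment> \<open>\<open>J\<close> bounds the inverse operator in the Euclidean norm;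
      \<open>c\<close> and \<open>K\<close> below compare that norm with the Riemannian norm at
      \<open>m\<^sub>0\<close> from the two sides.\<close>
    obtain J where J: "J > 0" "\<And>v. norm (inv A\<^sub>0 v) \<le> J * norm v"
      using linear_bounded_pos[OF lin] by blast
    obtain c where c: "c > 0" "\<And>v. c * norm v \<le> ?T v"
      using pos_def_coercive[OF B metric_rprod_pos[OF M' N']] unfolding tnorm_def by blast
    obtain K where K: "K \<ge> 0" "\<And>v. ?T v \<le> K * norm v"
      using bilinear_sqrt_bound[OF B] unfolding tnorm_def by blast
    obtain b where b: "\<And>z. \<bar>\<phi> z\<bar> \<le> b"
      using bd unfolding bounded_iff by auto
    \<comment> \<open>The constant records the route: dividing by \<open>c\<close> makes the score
      bound Euclidean, the scale term adds \<open>b * norm B\<^sub>0\<close>, \<open>J\<close>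
      accounts for the inverse, and \<open>K\<close> returns to the Riemannian norm.\<close>
    have "?T (IF\<^sub>s\<^sub>c z) \<le> K * (J * (1 / sqrt \<epsilon> / c + b * norm B\<^sub>0))" for z
    proof -
      have "c * norm (\<psi>\<^sub>0 z) \<le> 1 / sqrt \<epsilon>"
        using c(2) score_bound order_trans by blast
      then have \<psi>_le: "norm (\<psi>\<^sub>0 z) \<le> 1 / sqrt \<epsilon> / c"
        unfolding pos_le_divide_eq[OF c(1)] by (simp only: mult.commute)
      have "norm (\<psi>\<^sub>0 z + \<phi> z *\<^sub>R B\<^sub>0) \<le> norm (\<psi>\<^sub>0 z) + \<bar>\<phi> z\<bar> * norm B\<^sub>0"
        using norm_triangle_ineq[of "\<psi>\<^sub>0 z" "\<phi> z *\<^sub>R B\<^sub>0"] by simp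
      also have "\<dots> \<le> 1 / sqrt \<epsilon> / c + b * norm B\<^sub>0"
        using \<psi>_le b by (intro add_mono mult_right_mono) auto
      finally have le: "J * norm (\<psi>\<^sub>0 z + \<phi> z *\<^sub>R B\<^sub>0) \<le> J * (1 / sqrt \<epsilon> / c + b * norm B\<^sub>0)"
        using J(1) by (intro mult_left_mono) auto
      have "norm (IF\<^sub>s\<^sub>c z) \<le> J * norm (\<psi>\<^sub>0 z + \<phi> z *\<^sub>R B\<^sub>0)"
        unfolding IF\<^sub>s\<^sub>c norm_minus_cancel by (rule J(2))
      also note le
      finally show ?thesis
        using K(2)[of "IF\<^sub>s\<^sub>c z"] mult_left_mono[OF _ K(1)] order_trans by blast
    qed
    then show ?thesis
      by blast
  qed
  with score_bound show ?thesis
    by blast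
qed

end
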